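(* The compact 2-step nilmanifold $N^{j'}$ is not a naturally reductive Riemannian manifold.
   Context: Construction of $N^{j'}$: let $\mathbb H^*=\mathrm{Span}\{\mathbf i,\mathbf j,\mathbf k\}$ be the pure quaternions. Take $\mathfrak v=\mathbb H^*\oplus\mathbb H^*\cong\mathbb R^6$ with orthonormal basis $\{X_{\mathbf i},X_{\mathbf j},X_{\mathbf k},Y_{\mathbf i},Y_{\mathbf j},Y_{\mathbf k}\}$ (standard bases of first and second summand) and $\mathfrak z=\mathbb H^*\cong\mathbb R^3$ with orthonormal basis $\{Z_{\mathbf i},Z_{\mathbf j},Z_{\mathbf k}\}$, and let $\mathfrak n=\mathfrak v\oplus\mathfrak z$ be the orthogonal direct sum with inner product $g$. For $C\in\mathfrak z$ and $(L,R)\in\mathfrak v$ set $j'_C(L,R)=(\mathrm{Im}(R\cdot C),\mathrm{Im}(L\cdot C))$, with quaternion multiplication and $\mathrm{Im}$ the imaginary part; then $j'_C\in\mathfrak{so}(\mathfrak v)$. Let $\mathfrak n(j')$ be $\mathfrak n$ with the 2-step nilpotent Lie bracket determined by $[\mathfrak n,\mathfrak z]'=0$, $[\mathfrak v,\mathfrak v]'\subseteq\mathfrak z$, $g([V,W]',Z)=g(j'_ZV,W)$ for $V,W\in\mathfrak v$, $Z\in\mathfrak z$; let $N(j')$ be the simply connected Lie group with Lie algebra $\mathfrak n(j')$ and the left-invariant metric induced by $g$. Let $\mathcal R=\mathrm{Span}_{\mathbb Z}\{X_{\mathbf i},X_{\mathbf j},X_{\mathbf k},Y_{\mathbf i},Y_{\mathbf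 j},Y_{\mathbf k},\tfrac12Z_{\mathbf i},\tfrac12Z_{\mathbf j},\tfrac12Z_{\mathbf k}\}$ and $\Gamma(j')=\exp(\mathcal R)$, a cocompact discrete subgroup of $N(j')$. Then $N^{j'}=\Gamma(j')\backslash N(j')$ with the induced metric (the projection is a Riemannian covering). For a Riemannian manifold $(M,g)$ let $\nabla$ be the Levi-Civita connection and $R(X,Y)=[\nabla_X,\nabla_Y]-\nabla_{[X,Y]}$. A homogeneous structure on $(M,g)$ is a $(2,1)$-tensor field $T$, $(X,Y)\mapsto T_XY$, such that for all vector fields $V,X,Y,Z$: (1) $(\nabla_V R)(X,Y)Z=T_V(R(X,Y)Z)-R(T_VX,Y)Z-R(X,T_VY)Z-R(X,Y)(T_VZ)$; (2) $(\nabla_XT)_Y=[T_X,T_Y]-T_{T_XY}$; (3) $g(T_XY,Z)+g(Y,T_XZ)=0$. $(M,g)$ is naturally reductive if it admits a homogeneous structure $T$ with $T_XX=0$ for every vector field $X$. *)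

theory Defs
  imports
    "HOL-Analysis.Analysis"
    "HOL-Algebra.Coset"
    "HOL-Library.Function_Algebras"
begin

section \<open>Smooth manifolds given by an atlas\<close>

primrec times_cont_diff_on ::
  "nat \<Rightarrow> 'e::euclidean_space set \<Rightarrow> ('e \<Rightarrow> 'f::real_normed_vector) \<Rightarrow> bool" where
  "times_cont_diff_on 0 S f \<longleftrightarrow> continuous_on S f"
| "times_cont_diff_on (Suc k) S f \<longleftrightarrow>
     (\<exists>f'. (\<forall>x\<in>S. (f has_derivative f' x) (at x)) \<and>
           (\<forall>v. times_cont_diff_on k S (\<lambda>x. f' x v)))"

text \<open>Only used for open \<open>S\<close>.\<close>
definition smooth_on :: "'e::euclidean_space set \<Rightarrow> ('e \<Rightarrow> 'f::real_normed_vector) \<Rightarrow> bool" where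
  "smooth_on S f \<longleftrightarrow> (\<forall>k. times_cont_diff_on k S f)"

text \<open>
  A chart is a pair of its domain \<open>U\<close> and a map \<open>\<phi>\<close>, of which only the values on \<open>U\<close> matter.
  Two pairs whose maps differ only off \<open>U\<close> may both occur in an atlas; this is harmless.
\<close>
type_synonym ('m, 'e) chart = "'m set \<times> ('m \<Rightarrow> 'e)"

definition chart_inv :: "('m, 'e) chart \<Rightarrow> 'e \<Rightarrow> 'm" where
  "chart_inv c = inv_into (fst c) (snd c)"

definition chart_image :: "('m, 'e) chart \<Rightarrow> 'e set" where
  "chart_image c = snd c ` fst c"

definition points :: "('m, 'e) chart set \<Rightarrow> 'm set" where
  "points A = (\<Union>c\<in>A. fst c)"

definition chart_at :: "('m, 'e) chart set \<Rightarrow> 'm \<Rightarrow> ('m, 'e) chart" where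
  "chart_at A p = (SOME c. c \<in> A \<and> p \<in> fst c)"

text \<open>
  A tangent vector at \<open>p\<close> is the family of its component vectors in all charts around \<open>p\<close>,
  related by the derivatives of the coordinate changes. The components in the other charts
  are set to zero, so that equality and the pointwise \<open>+\<close>, \<open>-\<close>, \<open>0\<close> of functions
  are those of the tangent space.
\<close>
type_synonym ('m, 'e) tvec = "('m, 'e) chart \<Rightarrow> 'e"

definition tangent_space ::
  "('m, 'e::euclidean_space) chart set \<Rightarrow> 'm \<Rightarrow> ('m, 'e) tvec set" where
  "tangent_space A p =
     {v. (\<forall>c. c \<notin> A \<or> p \<notin> fst c \<longrightarrow> v c = 0) \<and>
         (\<forall>c\<in>A. \<forall>d\<in>A. p \<in> fst c \<inter> fst d \<longrightarrow>
            v d = frechet_derivative (snd d \<circ> chart_inv c) (at (snd c p)) (v c))}"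

definition tscale :: "real \<Rightarrow> ('m, 'e::real_vector) tvec \<Rightarrow> ('m, 'e) tvec" where
  "tscale a v = (\<lambda>c. a *\<^sub>R v c)"

text \<open>The differential at \<open>x\<close> of a map from a Euclidean space into the manifold.\<close>
definition differential ::
  "('m, 'e::euclidean_space) chart set \<Rightarrow> ('n::euclidean_space \<Rightarrow> 'm) \<Rightarrow> 'n \<Rightarrow> 'n \<Rightarrow> ('m, 'e) tvec"
where
  "differential A f x a =
     (\<lambda>c. if c \<in> A \<and> f x \<in> fst c then frechet_derivative (snd c \<circ> f) (at x) a else 0)"

definition smooth_function :: "('m, 'e::euclidean_space) chart set \<Rightarrow> ('m \<Rightarrow> real) \<Rightarrow> bool" where
  "smooth_function A f \<longleftrightarrow> (\<forall>c\<in>A. smooth_on (chart_image c) (f \<circ> chart_inv c))"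

type_synonym ('m, 'e) vfield = "'m \<Rightarrow> ('m, 'e) tvec"

definition components :: "('m, 'e) vfield \<Rightarrow> ('m, 'e) chart \<Rightarrow> 'e \<Rightarrow> 'e" where
  "components X c = (\<lambda>x. X (chart_inv c x) c)"

text \<open>Vector fields vanish outside the manifold, since \<^term>\<open>tangent_space A p\<close> is zero there.\<close>
definition vector_fields :: "('m, 'e::euclidean_space) chart set \<Rightarrow> ('m, 'e) vfield set" where
  "vector_fields A =
     {X. (\<forall>p. X p \<in> tangent_space A p) \<and>
         (\<forall>c\<in>A. smooth_on (chart_image c) (components X c))}"

definition fscale :: "('m \<Rightarrow> real) \<Rightarrow> ('m, 'e::real_vector) vfield \<Rightarrow> ('m, 'e) vfield" where
  "fscale f X = (\<lambda>p. tscale (f p) (X p))"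

text \<open>The derivative \<open>X f\<close> of a function along a vector field.\<close>
definition vderiv ::
  "('m, 'e::euclidean_space) chart set \<Rightarrow> ('m, 'e) vfield \<Rightarrow> ('m \<Rightarrow> real) \<Rightarrow> 'm \<Rightarrow> real" where
  "vderiv A X f p =
     (let c = chart_at A p
      in frechet_derivative (f \<circ> chart_inv c) (at (snd c p)) (X p c))"

definition lie_bracket ::
  "('m, 'e::euclidean_space) chart set \<Rightarrow> ('m, 'e) vfield \<Rightarrow> ('m, 'e) vfield \<Rightarrow> ('m, 'e) vfield" where
  "lie_bracket A X Y =
     (\<lambda>p c. if c \<in> A \<and> p \<in> fst c
            then frechet_derivative (components Y c) (at (snd c p)) (X p c)
               - frechet_derivative (components X c) (at (snd c p)) (Y p c)
            else 0)"


section \<open>Levi-Civita connection, homogeneous structures, natural reductivity\<close>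

type_synonym ('m, 'e) metric = "'m \<Rightarrow> ('m, 'e) tvec \<Rightarrow> ('m, 'e) tvec \<Rightarrow> real"
type_synonym ('m, 'e) connection = "('m, 'e) vfield \<Rightarrow> ('m, 'e) vfield \<Rightarrow> ('m, 'e) vfield"

definition metric_on_fields ::
  "('m, 'e) metric \<Rightarrow> ('m, 'e) vfield \<Rightarrow> ('m, 'e) vfield \<Rightarrow> 'm \<Rightarrow> real" where
  "metric_on_fields g X Y = (\<lambda>p. g p (X p) (Y p))"

text \<open>
  By the fundamental theorem of Riemannian geometry the following determines the values
  of \<open>D\<close> on vector fields uniquely.
\<close>
definition levi_civita ::
  "('m, 'e::euclidean_space) chart set \<Rightarrow> ('m, 'e) metric \<Rightarrow> ('m, 'e) connection \<Rightarrow> bool" where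
  "levi_civita A g D \<longleftrightarrow>
     (\<forall>X\<in>vector_fields A. \<forall>Y\<in>vector_fields A. D X Y \<in> vector_fields A) \<and>
     (\<forall>X\<in>vector_fields A. \<forall>X'\<in>vector_fields A. \<forall>Y\<in>vector_fields A.
        D (X + X') Y = D X Y + D X' Y) \<and>
     (\<forall>f. smooth_function A f \<longrightarrow> (\<forall>X\<in>vector_fields A. \<forall>Y\<in>vector_fields A.
        D (fscale f X) Y = fscale f (D X Y))) \<and>
     (\<forall>X\<in>vector_fields A. \<forall>Y\<in>vector_fields A. \<forall>Y'\<in>vector_fields A.
        D X (Y + Y') = D X Y + D X Y') \<and>
     (\<forall>f. smooth_function A f \<longrightarrow> (\<forall>X\<in>vector_fields A. \<forall>Y\<in>vector_fields A.
        D X (fscale f Y) = fscale f (D X Y) + fscale (vderiv A X f) Y)) \<and>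
     (\<forall>X\<in>vector_fields A. \<forall>Y\<in>vector_fields A. D X Y - D Y X = lie_bracket A X Y) \<and>
     (\<forall>X\<in>vector_fields A. \<forall>Y\<in>vector_fields A. \<forall>Z\<in>vector_fields A. \<forall>p\<in>points A.
        vderiv A X (metric_on_fields g Y Z) p =
          metric_on_fields g (D X Y) Z p + metric_on_fields g Y (D X Z) p)"

definition curvature ::
  "('m, 'e::euclidean_space) chart set \<Rightarrow> ('m, 'e) connection \<Rightarrow>
   ('m, 'e) vfield \<Rightarrow> ('m, 'e) vfield \<Rightarrow> ('m, 'e) vfield \<Rightarrow> ('m, 'e) vfield" where
  "curvature A D X Y Z = D X (D Y Z) - D Y (D X Z) - D (lie_bracket A X Y) Z"

text \<open>\<open>(\<nabla>\<^sub>V R)(X, Y)Z\<close>\<close>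
definition deriv_curvature ::
  "('m, 'e::euclidean_space) chart set \<Rightarrow> ('m, 'e) connection \<Rightarrow>
   ('m, 'e) vfield \<Rightarrow> ('m, 'e) vfield \<Rightarrow> ('m, 'e) vfield \<Rightarrow> ('m, 'e) vfield \<Rightarrow> ('m, 'e) vfield" where
  "deriv_curvature A D V X Y Z =
     D V (curvature A D X Y Z) - curvature A D (D V X) Y Z
       - curvature A D X (D V Y) Z - curvature A D X Y (D V Z)"

type_synonym ('m, 'e) tensor21 = "'m \<Rightarrow> ('m, 'e) tvec \<Rightarrow> ('m, 'e) tvec \<Rightarrow> ('m, 'e) tvec"

text \<open>\<open>T\<^sub>X Y\<close> for vector fields \<open>X\<close> and \<open>Y\<close>\<close>
definition on_fields ::
  "('m, 'e) tensor21 \<Rightarrow> ('m, 'e) vfield \<Rightarrow> ('m, 'e) vfield \<Rightarrow> ('m, 'e) vfield" where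
  "on_fields T X Y = (\<lambda>p. T p (X p) (Y p))"

text \<open>
  Smoothness of the tensor field, and \<open>T p\<close> having values in the tangent space at \<open>p\<close>, are
  expressed by the last conjunct.
\<close>
definition tensor_field21 ::
  "('m, 'e::euclidean_space) chart set \<Rightarrow> ('m, 'e) tensor21 \<Rightarrow> bool" where
  "tensor_field21 A T \<longleftrightarrow>
     (\<forall>p\<in>points A. \<forall>u\<in>tangent_space A p. \<forall>v\<in>tangent_space A p. \<forall>w\<in>tangent_space A p. \<forall>a.
        T p u v \<in> tangent_space A p \<and>
        T p (u + w) v = T p u v + T p w v \<and> T p (tscale a u) v = tscale a (T p u v) \<and>
        T p u (v + w) = T p u v + T p u w \<and> T p u (tscale a v) = tscale a (T p u v)) \<and>
     (\<forall>X\<in>vector_fields A. \<forall>Y\<in>vector_fields A. on_fields T X Y \<in> vector_fields A)"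

text \<open>\<open>(\<nabla>\<^sub>X T)\<^sub>Y Z\<close>\<close>
definition deriv_tensor21 ::
  "('m, 'e) connection \<Rightarrow> ('m, 'e::euclidean_space) tensor21 \<Rightarrow>
   ('m, 'e) vfield \<Rightarrow> ('m, 'e) vfield \<Rightarrow> ('m, 'e) vfield \<Rightarrow> ('m, 'e) vfield" where
  "deriv_tensor21 D T X Y Z =
     D X (on_fields T Y Z) - on_fields T (D X Y) Z - on_fields T Y (D X Z)"

definition homogeneous_structure ::
  "('m, 'e::euclidean_space) chart set \<Rightarrow> ('m, 'e) metric \<Rightarrow> ('m, 'e) connection \<Rightarrow>
   ('m, 'e) tensor21 \<Rightarrow> bool" where
  "homogeneous_structure A g D T \<longleftrightarrow> tensor_field21 A T \<and>
     (\<forall>V\<in>vector_fields A. \<forall>X\<in>vector_fields A. \<forall>Y\<in>vector_fields A. \<forall>Z\<in>vector_fields A.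
        deriv_curvature A D V X Y Z =
          on_fields T V (curvature A D X Y Z) - curvature A D (on_fields T V X) Y Z
            - curvature A D X (on_fields T V Y) Z - curvature A D X Y (on_fields T V Z)) \<and>
     (\<forall>X\<in>vector_fields A. \<forall>Y\<in>vector_fields A. \<forall>Z\<in>vector_fields A.
        deriv_tensor21 D T X Y Z =
          on_fields T X (on_fields T Y Z) - on_fields T Y (on_fields T X Z)
            - on_fields T (on_fields T X Y) Z) \<and>
     (\<forall>X\<in>vector_fields A. \<forall>Y\<in>vector_fields A. \<forall>Z\<in>vector_fields A. \<forall>p\<in>points A.
        metric_on_fields g (on_fields T X Y) Z p + metric_on_fields g Y (on_fields T X Z) p = 0)"

definition naturally_reductive ::
  "('m, 'e::euclidean_space) chart set \<Rightarrow> ('m, 'e) metric \<Rightarrow> bool" where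
  "naturally_reductive A g \<longleftrightarrow>
     (\<exists>D T. levi_civita A g D \<and> homogeneous_structure A g D T \<and>
            (\<forall>X\<in>vector_fields A. on_fields T X X = 0))"


section \<open>The Lie algebra \<open>\<nn>(j')\<close>\<close>

datatype quat = Quat (qre: real) (qi: real) (qj: real) (qk: real)

definition qmult :: "quat \<Rightarrow> quat \<Rightarrow> quat" where
  "qmult a b = Quat
     (qre a * qre b - qi a * qi b - qj a * qj b - qk a * qk b)
     (qre a * qi b + qi a * qre b + qj a * qk b - qk a * qj b)
     (qre a * qj b - qi a * qk b + qj a * qre b + qk a * qi b)
     (qre a * qk b + qi a * qj b - qj a * qi b + qk a * qre b)"

text \<open>
  The pure quaternions are represented by their coordinates with respect to \<open>i\<close>, \<open>j\<close>, \<open>k\<close>.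
\<close>
type_synonym pure = "real ^ 3"

definition quat_of_pure :: "pure \<Rightarrow> quat" where
  "quat_of_pure v = Quat 0 (v $ 1) (v $ 2) (v $ 3)"

definition quat_Im :: "quat \<Rightarrow> pure" where
  "quat_Im a = vector [qi a, qj a, qk a]"

type_synonym nil_v = "pure \<times> pure"
type_synonym nil_z = pure
type_synonym nil_n = "nil_v \<times> nil_z"

definition j' :: "nil_z \<Rightarrow> nil_v \<Rightarrow> nil_v" where
  "j' C V = (quat_Im (qmult (quat_of_pure (snd V)) (quat_of_pure C)),
             quat_Im (qmult (quat_of_pure (fst V)) (quat_of_pure C)))"

text \<open>
  The inner product \<open>g\<close> is the standard inner product of \<^typ>\<open>nil_n\<close>. The bracket of \<open>\<vv>\<close> is
  obtained by expanding \<open>g([V,W]', Z) = g(j'\<^sub>Z V, W)\<close> in an orthonormal basis of \<open>\<zz>\<close>.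
\<close>
definition nil_bracket :: "nil_n \<Rightarrow> nil_n \<Rightarrow> nil_n" where
  "nil_bracket x y = (0, \<Sum>b\<in>Basis. (j' b (fst x) \<bullet> fst y) *\<^sub>R b)"

lemma j'_eq: "j' C (L, R) = (cross3 R C, cross3 L C)"
  by (simp add: j'_def quat_Im_def qmult_def quat_of_pure_def cross3_def)

lemma nil_bracket_characterization:
  "nil_bracket x (0, Z) = 0"
  "nil_bracket (0, Z) x = 0"
  "fst (nil_bracket x y) = 0"
  "nil_bracket (V, 0) (W, 0) \<bullet> (0, Z) = j' Z V \<bullet> W"
proof -
  show "nil_bracket x (0, Z) = 0" by (simp add: nil_bracket_def flip: zero_prod_def)
  show "nil_bracket (0, Z) x = 0"
    by (simp add: nil_bracket_def zero_prod_def j'_eq inner_prod_def)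
  show "fst (nil_bracket x y) = 0" by (simp add: nil_bracket_def)
  obtain L R where V: "V = (L, R)" by (cases V)
  have lin: "linear (\<lambda>Z. j' Z V \<bullet> W)"
    unfolding V j'_eq
    by (rule linearI) (simp_all add: cross_add_right cross_mult_right inner_prod_def inner_add_left
        distrib_left)
  have "j' Z V \<bullet> W = j' (\<Sum>b\<in>Basis. (Z \<bullet> b) *\<^sub>R b) V \<bullet> W"
    by (simp add: euclidean_representation)
  also have "\<dots> = (\<Sum>b\<in>Basis. (Z \<bullet> b) * (j' b V \<bullet> W))"
    using linear_sum[OF lin, of "\<lambda>b. (Z \<bullet> b) *\<^sub>R b" Basis] linear_cmul[OF lin] by simp
  finally show "nil_bracket (V, 0) (W, 0) \<bullet> (0, Z) = j' Z V \<bullet> W"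
    by (simp add: nil_bracket_def inner_sum_left inner_commute[of Z] mult.commute)
qed


section \<open>The Riemannian manifold \<open>N\<^sup>j\<^sup>' = \<Gamma>(j')\<setminus>N(j')\<close>\<close>

text \<open>
  The simply connected group \<open>N(j')\<close> in exponential coordinates: the Baker-Campbell-Hausdorff
  product on \<open>\<nn>(j')\<close>, which for a 2-step nilpotent Lie algebra is \<open>x + y + [x,y]/2\<close>.
\<close>
definition nil_group :: "nil_n monoid" where
  "nil_group = \<lparr>carrier = UNIV,
                mult = (\<lambda>x y. x + y + (1/2) *\<^sub>R nil_bracket x y),
                one = 0\<rparr>"

lemma nil_bracket_linear:
  "nil_bracket (x + x') y = nil_bracket x y + nil_bracket x' y"
  "nil_bracket x (y + y') = nil_bracket x y + nil_bracket x y'"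
  "nil_bracket (r *\<^sub>R x) y = r *\<^sub>R nil_bracket x y"
  "nil_bracket x (r *\<^sub>R y) = r *\<^sub>R nil_bracket x y"
  by (cases x; cases x'; cases "fst x"; cases "fst x'";
      simp add: nil_bracket_def j'_eq cross_add_left cross_mult_left inner_prod_def
        inner_add_left inner_add_right sum.distrib[symmetric] scaleR_sum_right algebra_simps)+

lemma nil_bracket_alternating: "nil_bracket x x = 0"
proof -
  have "j' C V \<bullet> V = 0" for C V
    by (cases V) (simp add: j'_eq inner_prod_def cross3_simps inner_vec_def sum_3)
  then show ?thesis by (simp add: nil_bracket_def zero_prod_def)
qed

lemma nil_bracket_nested: "nil_bracket (nil_bracket x y) z = 0" "nil_bracket x (nil_bracket y z) = 0"
  by (metis nil_bracket_characterization prod.collapse)+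

lemma group_nil_group: "group nil_group"
proof (rule groupI)
  fix x assume "x \<in> carrier nil_group"
  have "nil_bracket (- x) x = 0"
    using nil_bracket_linear(3)[of "-1" x x] by (simp add: nil_bracket_alternating)
  then show "\<exists>y\<in>carrier nil_group. y \<otimes>\<^bsub>nil_group\<^esub> x = \<one>\<^bsub>nil_group\<^esub>"
    by (intro bexI[of _ "- x"]) (simp_all add: nil_group_def)
next
  fix x assume "x \<in> carrier nil_group"
  show "\<one>\<^bsub>nil_group\<^esub> \<otimes>\<^bsub>nil_group\<^esub> x = x"
    using nil_bracket_linear(3)[of 0 x x] by (simp add: nil_group_def)
qed (simp_all add: nil_group_def nil_bracket_linear nil_bracket_nested algebra_simps)

text \<open>In these coordinates the exponential map is the identity.\<close>
definition nil_exp :: "nil_n \<Rightarrow> nil_n" where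
  "nil_exp x = x"

text \<open>The left-invariant metric on \<open>N(j')\<close>: tangent vectors at \<open>n\<close> are translated to the identity.\<close>
definition nil_metric :: "nil_n \<Rightarrow> nil_n \<Rightarrow> nil_n \<Rightarrow> real" where
  "nil_metric n a b =
     (let dL = frechet_derivative (\<lambda>x. inv\<^bsub>nil_group\<^esub> n \<otimes>\<^bsub>nil_group\<^esub> x) (at n)
      in dL a \<bullet> dL b)"

definition int_span :: "'a::real_vector set \<Rightarrow> 'a set" where
  "int_span B = {\<Sum>b\<in>B. of_int (k b) *\<^sub>R b | k :: 'a \<Rightarrow> int. True}"

definition lattice_R :: "nil_n set" where
  "lattice_R = int_span
     ((\<lambda>i. ((axis i 1, 0), 0)) ` UNIV \<union> (\<lambda>i. ((0, axis i 1), 0)) ` UNIV \<union>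
      (\<lambda>i. ((0, 0), (1/2) *\<^sub>R axis i 1)) ` UNIV)"

definition Gamma :: "nil_n set" where
  "Gamma = nil_exp ` lattice_R"

definition nil_proj :: "nil_n \<Rightarrow> nil_n set" where
  "nil_proj n = Gamma #>\<^bsub>nil_group\<^esub> n"

text \<open>
  The points are the cosets \<open>\<Gamma>n\<close>. The charts are the inverses of the restrictions of the
  projection to the open sets on which it is injective.
\<close>
definition nilmanifold_atlas :: "(nil_n set, nil_n) chart set" where
  "nilmanifold_atlas =
     {(nil_proj ` B, inv_into B nil_proj) | B. open B \<and> inj_on nil_proj B}"

text \<open>
  The inner product on the tangent space at \<open>p\<close> for which the differential of the projection at
  a point \<open>n\<close> over \<open>p\<close> is an isometry; by left invariance it does not depend on \<open>n\<close>.
\<close>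
definition nilmanifold_metric :: "(nil_n set, nil_n) metric" where
  "nilmanifold_metric p u v =
     (let n = (SOME n. nil_proj n = p); lift = inv_into UNIV (differential nilmanifold_atlas nil_proj n)
      in nil_metric n (lift u) (lift v))"

end

(*
  A homogeneous structure T and the curvature R satisfy (nabla_V R)(X, Y)Z = (T_V . R)(X, Y)Z, which
  at one point is a linear system for T, with coefficients computed from the left-invariant metric.
  Take Z = V, so that T_V V = 0 kills the term R(X, Y)(T_V Z); tensoriality of R in its last argument,
  which rests on the symmetry of second derivatives, is then not needed. The component of this equation with
  (V, X, Y) = (X_i, X_i, Y_j) along Z_k forces g(T_{X_i} Y_j, Z_k) = -1/2, and the one with
  (V, X, Y) = (Z_k, X_k, Y_j) along Z_i forces g(T_{Z_k} Y_j, X_i) = -1/2. Since T is totally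
  skew-symmetric, these two numbers are negatives of each other, a contradiction.

  The left-invariant vector fields descend to the quotient and form a global orthonormal frame there,
  in which the Levi-Civita connection has constant coefficients given by the Koszul formula.
*)
theory Submission
  imports Defs
begin

section \<open>Smooth functions\<close>

text \<open>In a product rule one factor stays undifferentiated, so a factor of class k+1 must also
  be known to be of class k.\<close>

lemma times_cont_diff_on_SucD: "times_cont_diff_on (Suc k) S f \<Longrightarrow> times_cont_diff_on k S f"
proof (induction k arbitrary: f)
  case 0
  then obtain f' where "\<forall>x\<in>S. (f has_derivative f' x) (at x)" by auto
  then show ?case
    by (auto intro!: continuous_at_imp_continuous_on has_derivative_continuous)
next
  case (Suc k)
  from Suc.prems obtain f' where
    "\<forall>x\<in>S. (f has_derivative f' x) (at x)" "\<forall>v. times_cont_diff_on (Suc k) S (\<lambda>x. f' x v)"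
    unfolding times_cont_diff_on.simps(2)[of "Suc k"] by blast
  moreover from this(2) Suc.IH have "\<forall>v. times_cont_diff_on k S (\<lambda>x. f' x v)" by simp
  ultimately show ?case
    unfolding times_cont_diff_on.simps(2)[of k] by (intro exI[of _ f'] conjI)
qed

lemma times_cont_diff_on_cong:
  assumes "open S" "\<And>x. x \<in> S \<Longrightarrow> f x = g x" "times_cont_diff_on k S f"
  shows "times_cont_diff_on k S g"
proof (cases k)
  case 0
  then show ?thesis using assms by (simp cong: continuous_on_cong)
next
  case (Suc k)
  then obtain f' where f': "\<forall>x\<in>S. (f has_derivative f' x) (at x)"
      "\<forall>v. times_cont_diff_on k S (\<lambda>x. f' x v)"
    using assms(3) by auto
  have "\<forall>x\<in>S. (g has_derivative f' x) (at x)"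
    using f'(1) assms(1,2) by (auto intro: has_derivative_transform_within_open)
  with f'(2) Suc show ?thesis by auto
qed

lemma times_cont_diff_on_const: "times_cont_diff_on k S (\<lambda>x. c)"
proof (induction k arbitrary: c)
  case (Suc k)
  have "\<forall>x\<in>S. ((\<lambda>x. c) has_derivative (\<lambda>v. 0)) (at x)" by simp
  with Suc.IH[of 0] show ?case unfolding times_cont_diff_on.simps(2) by (intro exI[of _ "\<lambda>x v. 0"]) simp
qed simp

lemma times_cont_diff_on_id: "times_cont_diff_on k S (\<lambda>x. x)"
proof (cases k)
  case (Suc n)
  show ?thesis
    unfolding Suc times_cont_diff_on.simps(2)
    by (intro exI[of _ "\<lambda>x v. v"]) (simp add: times_cont_diff_on_const)
qed simp

lemma times_cont_diff_on_add:
  "times_cont_diff_on k S f \<Longrightarrow> times_cont_diff_on k S g \<Longrightarrow> times_cont_diff_on k S (\<lambda>x. f x + g x)"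
proof (induction k arbitrary: f g)
  case 0
  then show ?case by (simp add: continuous_on_add)
next
  case (Suc k)
  from Suc.prems obtain f' g' where
    "\<forall>x\<in>S. (f has_derivative f' x) (at x)" "\<forall>v. times_cont_diff_on k S (\<lambda>x. f' x v)"
    "\<forall>x\<in>S. (g has_derivative g' x) (at x)" "\<forall>v. times_cont_diff_on k S (\<lambda>x. g' x v)"
    by auto
  then have "\<forall>x\<in>S. ((\<lambda>x. f x + g x) has_derivative (\<lambda>v. f' x v + g' x v)) (at x)"
    and "\<forall>v. times_cont_diff_on k S (\<lambda>x. f' x v + g' x v)"
    by (simp_all add: has_derivative_add Suc.IH)
  then show ?case
    unfolding times_cont_diff_on.simps(2)
    by (intro exI[of _ "\<lambda>x v. f' x v + g' x v"] conjI)
qed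

text \<open>The derivative of a bilinear product is a sum of two products of the same kind, so the
  induction closes. Scaling, the inner product and the Lie bracket are all instances, and every
  expression below is built from these and sums.\<close>

lemma times_cont_diff_on_bilinear:
  assumes "bounded_bilinear h"
  shows "times_cont_diff_on k S f \<Longrightarrow> times_cont_diff_on k S g \<Longrightarrow>
    times_cont_diff_on k S (\<lambda>x. h (f x) (g x))"
proof (induction k arbitrary: f g)
  case 0
  then show ?case by (simp add: bounded_bilinear.continuous_on[OF assms])
next
  case (Suc k)
  from Suc.prems obtain f' g' where
    "\<forall>x\<in>S. (f has_derivative f' x) (at x)" "\<forall>v. times_cont_diff_on k S (\<lambda>x. f' x v)"
    "\<forall>x\<in>S. (g has_derivative g' x) (at x)" "\<forall>v. times_cont_diff_on k S (\<lambda>x. g' x v)"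
    by auto
  moreover have "times_cont_diff_on k S f" "times_cont_diff_on k S g"
    using Suc.prems by (auto simp del: times_cont_diff_on.simps dest: times_cont_diff_on_SucD)
  ultimately have "\<forall>x\<in>S. ((\<lambda>x. h (f x) (g x)) has_derivative (\<lambda>v. h (f x) (g' x v) + h (f' x v) (g x))) (at x)"
    and "\<forall>v. times_cont_diff_on k S (\<lambda>x. h (f x) (g' x v) + h (f' x v) (g x))"
    by (simp_all add: bounded_bilinear.FDERIV[OF assms] times_cont_diff_on_add Suc.IH)
  then show ?case
    unfolding times_cont_diff_on.simps(2)
    by (intro exI[of _ "\<lambda>x v. h (f x) (g' x v) + h (f' x v) (g x)"] conjI)
qed

lemma smooth_on_cong: "open S \<Longrightarrow> (\<And>x. x \<in> S \<Longrightarrow> f x = g x) \<Longrightarrow> smooth_on S f \<Longrightarrow> smooth_on S g"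
  unfolding smooth_on_def using times_cont_diff_on_cong by metis

lemma smooth_on_const: "smooth_on S (\<lambda>x. c)"
  by (simp add: smooth_on_def times_cont_diff_on_const)

lemma smooth_on_id: "smooth_on S (\<lambda>x. x)"
  by (simp add: smooth_on_def times_cont_diff_on_id)

lemma smooth_on_add: "smooth_on S f \<Longrightarrow> smooth_on S g \<Longrightarrow> smooth_on S (\<lambda>x. f x + g x)"
  by (simp add: smooth_on_def times_cont_diff_on_add)

lemma smooth_on_bilinear:
  "bounded_bilinear h \<Longrightarrow> smooth_on S f \<Longrightarrow> smooth_on S g \<Longrightarrow> smooth_on S (\<lambda>x. h (f x) (g x))"
  by (simp add: smooth_on_def times_cont_diff_on_bilinear)

lemmas smooth_on_scaleR = smooth_on_bilinear[OF bounded_bilinear_scaleR]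
lemmas smooth_on_inner = smooth_on_bilinear[OF bounded_bilinear_inner]

lemma smooth_on_diff:
  assumes "smooth_on S f" "smooth_on S g"
  shows "smooth_on S (\<lambda>x. f x - g x)"
  using smooth_on_add[OF assms(1) smooth_on_scaleR[OF smooth_on_const[of S "-1"] assms(2)]]
  by simp

section \<open>The lattice\<close>

lemma sum_mem:
  fixes f :: "'i \<Rightarrow> 'a::comm_monoid_add"
  assumes "0 \<in> P" "\<And>u v. u \<in> P \<Longrightarrow> v \<in> P \<Longrightarrow> u + v \<in> P" "\<And>i. i \<in> I \<Longrightarrow> f i \<in> P"
  shows "sum f I \<in> P"
  using assms by (induction I rule: infinite_finite_induct) auto

lemma int_span_add:
  assumes "x \<in> int_span B" "y \<in> int_span B"
  shows "x + y \<in> int_span B"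
proof -
  obtain k l :: "'a \<Rightarrow> int" where "x = (\<Sum>b\<in>B. of_int (k b) *\<^sub>R b)" "y = (\<Sum>b\<in>B. of_int (l b) *\<^sub>R b)"
    using assms by (auto simp: int_span_def)
  then have "x + y = (\<Sum>b\<in>B. of_int (k b + l b) *\<^sub>R b)"
    by (simp add: sum.distrib scaleR_add_left)
  then show ?thesis by (auto simp: int_span_def intro: exI[of _ "\<lambda>b. k b + l b"])
qed

lemma int_span_multiple:
  assumes "finite B" "b \<in> B" "r \<in> \<int>"
  shows "r *\<^sub>R b \<in> int_span B"
proof -
  obtain m where m: "r = of_int m" using assms(3) by (auto elim: Ints_cases)
  have "(\<Sum>c\<in>B. of_int (if c = b then m else 0) *\<^sub>R c) = (\<Sum>c\<in>B. if c = b then r *\<^sub>R b else 0)"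
    by (intro sum.cong) (auto simp: m)
  also have "\<dots> = r *\<^sub>R b" using assms by simp
  finally show ?thesis by (auto simp: int_span_def intro!: exI[of _ "\<lambda>c. if c = b then m else 0"])
qed

lemma int_span_sum: "(\<And>i. i \<in> I \<Longrightarrow> f i \<in> int_span B) \<Longrightarrow> sum f I \<in> int_span B"
proof (rule sum_mem[OF _ int_span_add])
  show "0 \<in> int_span B" by (auto simp: int_span_def intro!: exI[of _ "\<lambda>b. 0"])
qed

text \<open>Coordinatewise integrality is the form in which closure under the product and
  discreteness can be checked; the factor 2 comes from the halved generators of the centre.\<close>

lemma lattice_R_eq:
  "lattice_R = {((a, b), c). \<forall>i. a $ i \<in> \<int> \<and> b $ i \<in> \<int> \<and> 2 * c $ i \<in> \<int>}" (is "?L = ?P")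
proof (intro equalityI subsetI)
  define B :: "nil_n set" where "B = (\<lambda>i. ((axis i 1, 0), 0)) ` UNIV \<union> (\<lambda>i. ((0, axis i 1), 0)) ` UNIV \<union>
      (\<lambda>i. ((0, 0), (1/2) *\<^sub>R axis i 1)) ` UNIV"
  have L: "?L = int_span B" by (simp add: lattice_R_def B_def)
  have fin: "finite B" by (simp add: B_def)
  {
    fix x assume "x \<in> ?L"
    then obtain k :: "nil_n \<Rightarrow> int" where x: "x = (\<Sum>b\<in>B. of_int (k b) *\<^sub>R b)"
      unfolding L int_span_def by auto
    have zero: "0 \<in> ?P" by (auto simp: zero_prod_def)
    have add: "u + v \<in> ?P" if "u \<in> ?P" "v \<in> ?P" for u v
      using that by (auto simp: distrib_left)
    have multiple: "of_int (k b) *\<^sub>R b \<in> ?P" if "b \<in> B" for b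
      using that by (auto simp: B_def axis_def)
    from zero add multiple have "(\<Sum>b\<in>B. of_int (k b) *\<^sub>R b) \<in> ?P" by (rule sum_mem)
    then show "x \<in> ?P" using x by simp
  }
  {
    fix x assume "x \<in> ?P"
    then obtain a b c where x: "x = ((a, b), c)"
      and i: "\<And>i. a $ i \<in> \<int>" "\<And>i. b $ i \<in> \<int>" "\<And>i. 2 * c $ i \<in> \<int>" by auto
    have "x = (\<Sum>i\<in>UNIV. a $ i *\<^sub>R ((axis i 1, 0), 0)) + (\<Sum>i\<in>UNIV. b $ i *\<^sub>R ((0, axis i 1), 0))
        + (\<Sum>i\<in>UNIV. (2 * c $ i) *\<^sub>R ((0, 0), (1/2) *\<^sub>R axis i 1))"
      by (simp add: x sum_3 vec_eq_iff axis_def forall_3)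
    also have "\<dots> \<in> ?L"
      unfolding L by (intro int_span_add int_span_sum int_span_multiple fin i) (auto simp: B_def)
    finally show "x \<in> ?L" .
  }
qed

section \<open>The group and the charts of the quotient\<close>

text \<open>Both sides have the same inner product with every vector, by the cyclic symmetry of the
  scalar triple product: \<open>cross3 R w\<close> paired with \<open>L'\<close> equals
  \<open>cross3 L' R\<close> paired with \<open>w\<close>.\<close>

lemma nil_bracket_eq:
  "nil_bracket ((L, R), C) ((L', R'), C') = (0, cross3 L' R + cross3 R' L)"
proof -
  have "nil_bracket ((L, R), C) ((L', R'), C') \<bullet> ((u, v), w) = (0, cross3 L' R + cross3 R' L) \<bullet> ((u, v), w)" for u v w
  proof -
    have "nil_bracket ((L, R), C) ((L', R'), C') =
       nil_bracket ((L, R), 0) ((L', R'), 0)"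
      by (simp add: nil_bracket_def)
    then show ?thesis
      using nil_bracket_characterization(4)[of "(L, R)" "(L', R')" w]
      by (simp add: nil_bracket_def j'_eq inner_prod_def)
         (simp add: inner_vec_def sum_3 cross3_simps)
  qed
  then show ?thesis by (metis (no_types, lifting) vector_eq_rdot prod.collapse)
qed

lemma bounded_bilinear_nil_bracket: "bounded_bilinear nil_bracket"
  by (simp add: bilinear_conv_bounded_bilinear[symmetric] bilinear_def linear_iff nil_bracket_linear)

interpretation nil_bracket: bounded_bilinear nil_bracket
  by (rule bounded_bilinear_nil_bracket)

lemma nil_bracket_swap: "nil_bracket y x = - nil_bracket x y"
proof -
  have "nil_bracket (x + y) (x + y) = nil_bracket x y + nil_bracket y x"
    unfolding nil_bracket_linear by (simp add: nil_bracket_alternating)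
  then show ?thesis by (simp add: nil_bracket_alternating eq_neg_iff_add_eq_0 add.commute)
qed

abbreviation nil_mult :: "nil_n \<Rightarrow> nil_n \<Rightarrow> nil_n" where
  "nil_mult x y \<equiv> x + y + (1/2) *\<^sub>R nil_bracket x y"

lemma nil_group_simps [simp]:
  "carrier nil_group = UNIV" "x \<otimes>\<^bsub>nil_group\<^esub> y = nil_mult x y" "\<one>\<^bsub>nil_group\<^esub> = 0"
  by (simp_all add: nil_group_def)

lemma inv_nil_group [simp]: "inv\<^bsub>nil_group\<^esub> x = - x"
  by (rule group.inv_equality[OF group_nil_group])
    (simp_all add: nil_bracket.minus_left nil_bracket_alternating)

lemma Gamma_eq: "Gamma = {((a, b), c). \<forall>i. a $ i \<in> \<int> \<and> b $ i \<in> \<int> \<and> 2 * c $ i \<in> \<int>}"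
  by (simp add: Gamma_def nil_exp_def[abs_def] lattice_R_eq)

lemma cross3_Ints: "(\<And>i. u $ i \<in> \<int>) \<Longrightarrow> (\<And>i. v $ i \<in> \<int>) \<Longrightarrow> cross3 u v $ i \<in> \<int>"
  using exhaust_3[of i] by (auto simp: cross3_def)

text \<open>The bracket of integral vectors is integral, and the product halves it. This is why
  half-integers must be allowed in the centre.\<close>

lemma subgroup_Gamma: "subgroup Gamma nil_group"
proof
  fix x y assume "x \<in> Gamma" "y \<in> Gamma"
  then obtain a b c a' b' c' where xy: "x = ((a, b), c)" "y = ((a', b'), c')"
    and i: "\<And>i. a $ i \<in> \<int>" "\<And>i. b $ i \<in> \<int>" "\<And>i. 2 * c $ i \<in> \<int>"
      "\<And>i. a' $ i \<in> \<int>" "\<And>i. b' $ i \<in> \<int>" "\<And>i. 2 * c' $ i \<in> \<int>"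
    by (auto simp: Gamma_eq)
  show "x \<otimes>\<^bsub>nil_group\<^esub> y \<in> Gamma"
    by (simp add: xy Gamma_eq nil_bracket_eq distrib_left) (simp add: i cross3_Ints)
next
  fix x assume "x \<in> Gamma"
  then show "inv\<^bsub>nil_group\<^esub> x \<in> Gamma" by (auto simp: Gamma_eq)
qed (auto simp: Gamma_eq zero_prod_def)

text \<open>The fibres of the projection are the orbits of left translations by
  \<open>Gamma\<close>, which is why left-invariant objects descend to the quotient.\<close>

lemma nil_proj_eq_iff: "nil_proj x = nil_proj y \<longleftrightarrow> (\<exists>\<gamma>\<in>Gamma. y = nil_mult \<gamma> x)"
proof
  assume "nil_proj x = nil_proj y"
  moreover have "y \<in> nil_proj y"
    by (simp add: nil_proj_def group.rcos_self[OF group_nil_group] subgroup_Gamma)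
  ultimately show "\<exists>\<gamma>\<in>Gamma. y = nil_mult \<gamma> x" by (auto simp: nil_proj_def r_coset_def)
next
  assume "\<exists>\<gamma>\<in>Gamma. y = nil_mult \<gamma> x"
  then have "y \<in> Gamma #>\<^bsub>nil_group\<^esub> x" by (auto simp: r_coset_def)
  then show "nil_proj x = nil_proj y"
    unfolding nil_proj_def
    by (intro group.repr_independence[OF group_nil_group]) (simp_all add: subgroup_Gamma)
qed

text \<open>Two points of the ball differ by less than 1/4. An element of \<open>Gamma\<close>
  relating them then has coordinates too small to be nonzero: first those that are integers, then
  the half-integral central ones.\<close>

lemma inj_on_nil_proj_ball: "inj_on nil_proj (ball 0 (1/8))"
proof (rule inj_onI)
  fix x y assume xy: "x \<in> ball 0 (1/8)" "y \<in> ball 0 (1/8)" "nil_proj x = nil_proj y"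
  then obtain \<gamma> where g: "\<gamma> \<in> Gamma" "y = nil_mult \<gamma> x" by (auto simp: nil_proj_eq_iff)
  have "norm (y - x) < 1/4" using xy(1,2) norm_triangle_ineq4[of y x] by simp
  moreover obtain L R C L' R' C' where L: "x = ((L, R), C)" "y = ((L', R'), C')" 
    by (metis prod.collapse)
  ultimately have n: "norm (L' - L) < 1/4" "norm (R' - R) < 1/4" "norm (C' - C) < 1/4"
    using norm_fst_le[of "(L' - L, R' - R)" "C' - C"] norm_snd_le[of "C' - C" "(L' - L, R' - R)"]
      norm_fst_le[of "L' - L" "R' - R"] norm_snd_le[of "R' - R" "L' - L"]
    by (simp_all add: L)
  obtain L0 R0 C0 where G: "\<gamma> = ((L0, R0), C0)" by (metis prod.collapse)
  have int_zero: "r = 0" if "\<bar>r\<bar> < 1" "r \<in> \<int>" for r :: real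
    using that by (auto elim!: Ints_cases)
  have d: "L0 = L' - L" "R0 = R' - R"
    "C' - C = C0 + (1/2) *\<^sub>R (cross3 L R0 + cross3 R L0)"
    using g(2) by (auto simp: L G nil_bracket_eq)
  have int: "L0 $ i \<in> \<int>" "R0 $ i \<in> \<int>" "2 * C0 $ i \<in> \<int>" for i
    using g(1) by (auto simp: G Gamma_eq)
  have "\<bar>L0 $ i\<bar> < 1" "\<bar>R0 $ i\<bar> < 1" for i
    using n(1,2) component_le_norm_cart[of L0 i] component_le_norm_cart[of R0 i]
    unfolding d(1,2) by linarith+
  then have "L0 $ i = 0" "R0 $ i = 0" for i
    using int int_zero by blast+
  then have LR: "L0 = 0" "R0 = 0" by (simp_all add: vec_eq_iff)
  \<comment> \<open>With \<open>L0\<close> and \<open>R0\<close> zero the bracket term is gone, so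
    \<open>C0 = C' - C\<close> and its doubled entries stay below 1/2.\<close>
  have "\<bar>2 * C0 $ i\<bar> < 1" for i
    using n(3) component_le_norm_cart[of C0 i] d(3) by (simp add: LR)
  then have "2 * C0 $ i = 0" for i by (rule int_zero[OF _ int(3)])
  then have "C0 = 0" by (simp add: vec_eq_iff)
  then show "x = y" using d LR by (simp add: L)
qed

section \<open>Charts as local inverses of the projection\<close>

abbreviation "\<A> \<equiv> nilmanifold_atlas"

text \<open>The coordinates of a coset in a chart are one of its representatives in the group. Hence
  \<open>chart_inv\<close> is the projection itself, and computations in charts become computations
  in the group.\<close>

lemma chart_cases:
  assumes "c \<in> \<A>"
  obtains B where "open B" "inj_on nil_proj B" "fst c = nil_proj ` B" "chart_image c = B"
    "\<And>x. x \<in> B \<Longrightarrow> chart_inv c x = nil_proj x" "\<And>x. x \<in> B \<Longrightarrow> snd c (nil_proj x) = x"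
proof -
  obtain B where B: "open B" "inj_on nil_proj B" and c: "c = (nil_proj ` B, inv_into B nil_proj)"
    using assms by (auto simp: nilmanifold_atlas_def)
  have s: "snd c (nil_proj x) = x" if "x \<in> B" for x
    using that B(2) by (simp add: c)
  have im: "chart_image c = B"
    using s by (force simp: chart_image_def c)
  have "inj_on (snd c) (fst c)" using B(2) by (simp add: c inj_on_inv_into)
  then have "chart_inv c x = nil_proj x" if "x \<in> B" for x
    using that s[OF that] inv_into_f_f[of "snd c" "fst c" "nil_proj x"] by (simp add: chart_inv_def c)
  with B s im show ?thesis by (intro that[of B]) (simp_all add: c)
qed

lemma open_chart_image: "c \<in> \<A> \<Longrightarrow> open (chart_image c)"
  by (metis chart_cases)

lemma chart_inv_nil_proj: "c \<in> \<A> \<Longrightarrow> x \<in> chart_image c \<Longrightarrow> chart_inv c x = nil_proj x"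
  by (metis chart_cases)

lemma nil_proj_in_chart: "c \<in> \<A> \<Longrightarrow> x \<in> chart_image c \<Longrightarrow> nil_proj x \<in> fst c"
  by (metis chart_cases imageI)

lemma chart_nil_proj: "c \<in> \<A> \<Longrightarrow> x \<in> chart_image c \<Longrightarrow> snd c (nil_proj x) = x"
  by (metis chart_cases)

lemma snd_chart:
  assumes "c \<in> \<A>" "p \<in> fst c"
  shows "snd c p \<in> chart_image c" "nil_proj (snd c p) = p"
proof -
  obtain B where "fst c = nil_proj ` B" "chart_image c = B"
    "\<And>x. x \<in> B \<Longrightarrow> snd c (nil_proj x) = x" using assms(1) by (metis chart_cases)
  then show "snd c p \<in> chart_image c" "nil_proj (snd c p) = p" using assms(2) by auto
qed

text \<open>The contradiction is derived at a point of the manifold, so one has to exist; conditions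
  on an empty manifold would hold vacuously.\<close>

lemma origin_in_points: "nil_proj 0 \<in> points \<A>"
proof -
  have "(nil_proj ` ball 0 (1/8), inv_into (ball 0 (1/8)) nil_proj) \<in> \<A>"
    using inj_on_nil_proj_ball by (auto simp: nilmanifold_atlas_def)
  then show ?thesis unfolding points_def by force
qed

text \<open>The differential at the identity of the left translation by \<open>n\<close> is \<open>left_trans n\<close>.\<close>
definition left_trans :: "nil_n \<Rightarrow> nil_n \<Rightarrow> nil_n" where
  "left_trans n a = a + (1/2) *\<^sub>R nil_bracket n a"

lemma left_trans_linear:
  "left_trans n (a + b) = left_trans n a + left_trans n b"
  "left_trans n (r *\<^sub>R a) = r *\<^sub>R left_trans n a"
  by (simp_all add: left_trans_def nil_bracket_linear algebra_simps)

text \<open>This is the chain rule for left translations; the terms that could differ are nested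
  brackets, which vanish in two steps.\<close>

lemma left_trans_nil_mult: "left_trans (nil_mult m n) a = left_trans m (left_trans n a)"
  by (simp add: left_trans_def nil_bracket_linear nil_bracket_nested algebra_simps)

lemma left_trans_minus [simp]:
  "left_trans n (left_trans (- n) a) = a" "left_trans (- n) (left_trans n a) = a"
  by (simp_all add: left_trans_def nil_bracket_linear nil_bracket_nested nil_bracket.minus_left
      nil_bracket.diff_right)

lemma has_derivative_nil_mult: "((\<lambda>y. nil_mult n y) has_derivative left_trans n) (at x)"
  unfolding left_trans_def[abs_def]
  by (auto intro!: derivative_eq_intros bounded_linear.has_derivative[OF nil_bracket.bounded_linear_right])

text \<open>Near \<open>x\<close> the map is left translation by one fixed element
  \<open>\<gamma>\<close> of \<open>Gamma\<close>, the one taking \<open>x\<close> to the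
  representative that \<open>d\<close> selects. Its derivative is then expressed through the two
  representatives alone.\<close>

lemma chart_local_lift:
  assumes "d \<in> \<A>" "nil_proj x \<in> fst d"
  shows "((\<lambda>y. snd d (nil_proj y)) has_derivative (\<lambda>a. left_trans (snd d (nil_proj x)) (left_trans (- x) a))) (at x)"
proof -
  obtain \<gamma> where g: "\<gamma> \<in> Gamma" "snd d (nil_proj x) = nil_mult \<gamma> x"
    using snd_chart(2)[OF assms] by (metis nil_proj_eq_iff)
  \<comment> \<open>On this open set the translate by \<open>\<gamma>\<close> stays in the image of
    \<open>d\<close>, so it is the representative that \<open>d\<close> selects.\<close>
  define U where "U = (\<lambda>y. nil_mult \<gamma> y) -` chart_image d"
  have "continuous_on UNIV (\<lambda>y. nil_mult \<gamma> y)"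
    by (intro continuous_intros nil_bracket.continuous_on)
  then have U: "open U" unfolding U_def by (intro open_vimage open_chart_image assms)
  have "nil_mult \<gamma> y = snd d (nil_proj y)" if "y \<in> U" for y
  proof -
    have "nil_proj y = nil_proj (nil_mult \<gamma> y)" using g(1) by (auto simp: nil_proj_eq_iff)
    with that show ?thesis unfolding U_def using chart_nil_proj[OF assms(1)] by auto
  qed
  moreover have "x \<in> U" using snd_chart(1)[OF assms] by (simp add: U_def g(2))
  ultimately have "((\<lambda>y. snd d (nil_proj y)) has_derivative left_trans \<gamma>) (at x)"
    by (intro has_derivative_transform_within_open[OF has_derivative_nil_mult U])
  also have "left_trans \<gamma> = (\<lambda>a. left_trans (snd d (nil_proj x)) (left_trans (- x) a))"
    unfolding g(2) left_trans_nil_mult by simp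
  finally show ?thesis .
qed

text \<open>Consequently, for a tangent vector \<open>v\<close> at \<open>p\<close>, the vector
  \<open>left_trans (- snd c p) (v c)\<close> is the same for all charts \<open>c\<close> around
  \<open>p\<close>. This common value is its coefficient in the frame.\<close>

lemma transition_derivative:
  assumes "c \<in> \<A>" "d \<in> \<A>" "p \<in> fst c" "p \<in> fst d"
  shows "frechet_derivative (snd d \<circ> chart_inv c) (at (snd c p)) =
    (\<lambda>a. left_trans (snd d p) (left_trans (- snd c p) a))"
proof -
  have "((\<lambda>y. snd d (nil_proj y)) has_derivative
      (\<lambda>a. left_trans (snd d p) (left_trans (- snd c p) a))) (at (snd c p))"
    using chart_local_lift[of d "snd c p"] assms by (simp add: snd_chart)
  then have "((snd d \<circ> chart_inv c) has_derivative
      (\<lambda>a. left_trans (snd d p) (left_trans (- snd c p) a))) (at (snd c p))"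
    by (rule has_derivative_transform_within_open[where s = "chart_image c"])
      (use assms in \<open>auto simp: open_chart_image snd_chart chart_inv_nil_proj\<close>)
  then show ?thesis by (rule frechet_derivative_at[symmetric])
qed

section \<open>The left-invariant frame\<close>

text \<open>The left-invariant field with value \<open>a\<close> at the identity, pushed down to the
  quotient. It is indexed linearly by the whole Lie algebra, so that no basis has to be fixed; the
  zeros follow the convention of \<open>tangent_space\<close>.\<close>

definition frame :: "nil_n \<Rightarrow> (nil_n set, nil_n) vfield" where
  "frame a p = (\<lambda>c. if c \<in> \<A> \<and> p \<in> fst c then left_trans (snd c p) a else 0)"

lemma frame_apply: "c \<in> \<A> \<Longrightarrow> p \<in> fst c \<Longrightarrow> frame a p c = left_trans (snd c p) a"
  by (simp add: frame_def)

lemma frame_add: "frame (a + b) = frame a + frame b"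
  by (auto simp: frame_def fun_eq_iff left_trans_linear)

lemma frame_scale: "frame (r *\<^sub>R a) p = tscale r (frame a p)"
  by (auto simp: frame_def fun_eq_iff left_trans_linear tscale_def)

lemma frame_minus: "frame (- a) = - frame a"
  using frame_scale[of "-1" a] by (auto simp: fun_eq_iff tscale_def)

lemma frame_diff: "frame (a - b) = frame a - frame b"
  using frame_add[of a "- b"] by (simp add: frame_minus)

lemma frame_zero: "frame 0 = 0"
  using frame_diff[of 0 0] by simp

lemma pointE:
  assumes "p \<in> points \<A>"
  obtains c where "c \<in> \<A>" "p \<in> fst c"
  using assms unfolding points_def by blast

lemma pointI: "c \<in> \<A> \<Longrightarrow> p \<in> fst c \<Longrightarrow> p \<in> points \<A>"
  unfolding points_def by blast

lemma frame_inject: "p \<in> points \<A> \<Longrightarrow> frame a p = frame b p \<longleftrightarrow> a = b"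
  by (elim pointE) (metis frame_apply left_trans_minus(2))

lemma frame_tangent: "frame a p \<in> tangent_space \<A> p"
  unfolding tangent_space_def
proof (intro CollectI conjI allI ballI impI)
  fix c assume "c \<notin> \<A> \<or> p \<notin> fst c"
  then show "frame a p c = 0" by (auto simp: frame_def)
next
  fix c d assume "c \<in> \<A>" "d \<in> \<A>" "p \<in> fst c \<inter> fst d"
  then show "frame a p d = frechet_derivative (snd d \<circ> chart_inv c) (at (snd c p)) (frame a p c)"
    by (simp add: transition_derivative frame_apply)
qed

text \<open>Through the coordinate changes, the component in a single chart determines a tangent
  vector, so it is enough to match the frame there.\<close>

lemma tangent_eq_frame:
  assumes "v \<in> tangent_space \<A> p" "c \<in> \<A>" "p \<in> fst c"
  shows "v = frame (left_trans (- snd c p) (v c)) p"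
proof
  fix d
  show "v d = frame (left_trans (- snd c p) (v c)) p d"
  proof (cases "d \<in> \<A> \<and> p \<in> fst d")
    case True
    then have "v d = frechet_derivative (snd d \<circ> chart_inv c) (at (snd c p)) (v c)"
      using assms unfolding tangent_space_def by blast
    then show ?thesis using True assms by (simp add: transition_derivative frame_apply)
  next
    case False
    then have "v d = 0" using assms(1) unfolding tangent_space_def by blast
    with False show ?thesis by (auto simp: frame_def)
  qed
qed

text \<open>Fields are functions on all sets of group elements, so an equality of fields must also
  be checked at sets that are not cosets in the manifold.\<close>

lemma tangent_not_point: "v \<in> tangent_space \<A> p \<Longrightarrow> p \<notin> points \<A> \<Longrightarrow> v = 0"
proof (rule ext)
  fix c
  assume "v \<in> tangent_space \<A> p" "p \<notin> points \<A>"
  then have "v c = 0" unfolding points_def tangent_space_def by blast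
  then show "v c = 0 c" by simp
qed

definition frame_coeff :: "nil_n set \<Rightarrow> (nil_n set, nil_n) tvec \<Rightarrow> nil_n" where
  "frame_coeff p v = (THE a. v = frame a p)"

lemma frame_coeff_frame [simp]: "p \<in> points \<A> \<Longrightarrow> frame_coeff p (frame a p) = a"
  by (auto simp: frame_coeff_def frame_inject)

lemma frame_frame_coeff: "v \<in> tangent_space \<A> p \<Longrightarrow> frame (frame_coeff p v) p = v"
proof (cases "p \<in> points \<A>")
  case True
  assume "v \<in> tangent_space \<A> p"
  with True obtain a where "v = frame a p" by (metis pointE tangent_eq_frame)
  with True show ?thesis by simp
\<comment> \<open>Off the manifold all frame vectors are zero, so the unspecified value of
  \<open>frame_coeff\<close> is harmless.\<close>
qed (metis tangent_not_point frame_tangent)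

section \<open>Smooth vector fields and their coefficients in the frame\<close>

lemma vector_fieldI:
  "(\<And>p. X p \<in> tangent_space \<A> p) \<Longrightarrow>
    (\<And>c. c \<in> \<A> \<Longrightarrow> smooth_on (chart_image c) (components X c)) \<Longrightarrow> X \<in> vector_fields \<A>"
  unfolding vector_fields_def by blast

lemma vector_field_smooth:
  "X \<in> vector_fields \<A> \<Longrightarrow> c \<in> \<A> \<Longrightarrow> smooth_on (chart_image c) (components X c)"
  unfolding vector_fields_def by blast

lemma vector_field_tangent: "X \<in> vector_fields \<A> \<Longrightarrow> X p \<in> tangent_space \<A> p"
  by (simp add: vector_fields_def)

lemma frame_coeff_apply:
  "v \<in> tangent_space \<A> p \<Longrightarrow> c \<in> \<A> \<Longrightarrow> p \<in> fst c \<Longrightarrow>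
    frame_coeff p v = left_trans (- snd c p) (v c)"
  by (metis frame_frame_coeff frame_apply left_trans_minus(2))

lemma smooth_on_left_trans:
  "smooth_on S f \<Longrightarrow> smooth_on S g \<Longrightarrow> smooth_on S (\<lambda>x. left_trans (f x) (g x))"
  unfolding left_trans_def
  by (intro smooth_on_add smooth_on_scaleR smooth_on_const smooth_on_bilinear[OF bounded_bilinear_nil_bracket])

lemma tangent_space_closed:
  assumes "u \<in> tangent_space \<A> p" "v \<in> tangent_space \<A> p"
  shows "u - v \<in> tangent_space \<A> p" "u + v \<in> tangent_space \<A> p" "tscale r u \<in> tangent_space \<A> p"
proof -
  obtain a b where "u = frame a p" "v = frame b p" using assms by (metis frame_frame_coeff)
  then have "u - v = frame (a - b) p" "u + v = frame (a + b) p" "tscale r u = frame (r *\<^sub>R a) p"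
    by (simp_all add: frame_diff frame_add frame_scale)
  then show "u - v \<in> tangent_space \<A> p" "u + v \<in> tangent_space \<A> p" "tscale r u \<in> tangent_space \<A> p"
    by (simp_all only: frame_tangent)
qed

lemma frame_vector_field: "frame a \<in> vector_fields \<A>"
proof -
  have "smooth_on (chart_image c) (components (frame a) c)" if "c \<in> \<A>" for c
  proof (rule smooth_on_cong)
    show "smooth_on (chart_image c) (\<lambda>x. left_trans x a)"
      by (intro smooth_on_left_trans smooth_on_id smooth_on_const)
  qed (use that in \<open>auto simp: open_chart_image components_def chart_inv_nil_proj frame_apply
        nil_proj_in_chart chart_nil_proj\<close>)
  then show ?thesis by (intro vector_fieldI frame_tangent)
qed

lemma vector_field_diff:
  assumes "X \<in> vector_fields \<A>" "Y \<in> vector_fields \<A>"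
  shows "X - Y \<in> vector_fields \<A>"
proof -
  have "components (X - Y) c = (\<lambda>x. components X c x - components Y c x)" for c
    by (simp add: components_def fun_eq_iff)
  with assms show ?thesis
    by (intro vector_fieldI)
      (simp_all add: vector_field_smooth smooth_on_diff tangent_space_closed vector_field_tangent)
qed

lemma vector_field_add:
  assumes "X \<in> vector_fields \<A>" "Y \<in> vector_fields \<A>"
  shows "X + Y \<in> vector_fields \<A>"
proof -
  have "components (X + Y) c = (\<lambda>x. components X c x + components Y c x)" for c
    by (simp add: components_def fun_eq_iff)
  with assms show ?thesis
    by (intro vector_fieldI)
      (simp_all add: vector_field_smooth smooth_on_add tangent_space_closed vector_field_tangent)
qed

lemma vector_field_sum:
  "(\<And>i. i \<in> I \<Longrightarrow> X i \<in> vector_fields \<A>) \<Longrightarrow> (\<Sum>i\<in>I. X i) \<in> vector_fields \<A>"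
  by (rule sum_mem) (auto intro: vector_field_add simp: frame_vector_field simp flip: frame_zero)

lemma vector_field_fscale:
  assumes "smooth_function \<A> f" "X \<in> vector_fields \<A>"
  shows "fscale f X \<in> vector_fields \<A>"
proof -
  have "components (fscale f X) c = (\<lambda>x. (f \<circ> chart_inv c) x *\<^sub>R components X c x)" for c
    by (simp add: components_def fun_eq_iff fscale_def tscale_def)
  then have "smooth_on (chart_image c) (components (fscale f X) c)" if "c \<in> \<A>" for c
    using assms that by (simp add: vector_field_smooth smooth_function_def smooth_on_scaleR del: comp_apply)
  moreover have "fscale f X p \<in> tangent_space \<A> p" for p
    unfolding fscale_def using assms(2) by (metis vector_field_tangent tangent_space_closed(3))
  ultimately show ?thesis by (rule vector_fieldI[rotated])
qed

text \<open>In a chart the coefficient vector is \<open>left_trans (- x)\<close> applied to the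
  component at \<open>x\<close>, which is built from smooth functions by the bracket and
  sums.\<close>

lemma smooth_function_frame_coeff:
  assumes "X \<in> vector_fields \<A>"
  shows "smooth_function \<A> (\<lambda>p. frame_coeff p (X p) \<bullet> b)"
  unfolding smooth_function_def
proof
  fix c assume c: "c \<in> \<A>"
  show "smooth_on (chart_image c) ((\<lambda>p. frame_coeff p (X p) \<bullet> b) \<circ> chart_inv c)"
  proof (rule smooth_on_cong)
    have "smooth_on (chart_image c) (\<lambda>x. - 1 *\<^sub>R x)"
      by (intro smooth_on_scaleR smooth_on_const smooth_on_id)
    then have "smooth_on (chart_image c) (\<lambda>x. - x)" by simp
    then show "smooth_on (chart_image c) (\<lambda>x. left_trans (- x) (components X c x) \<bullet> b)"
      using assms c by (intro smooth_on_inner smooth_on_left_trans smooth_on_const vector_field_smooth)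
    fix x assume x: "x \<in> chart_image c"
    then have "frame_coeff (nil_proj x) (X (nil_proj x)) = left_trans (- x) (X (nil_proj x) c)"
      using frame_coeff_apply[OF vector_field_tangent[OF assms] c nil_proj_in_chart[OF c x]]
      by (simp add: chart_nil_proj c)
    with x c show "left_trans (- x) (components X c x) \<bullet> b = ((\<lambda>p. frame_coeff p (X p) \<bullet> b) \<circ> chart_inv c) x"
      by (simp add: components_def chart_inv_nil_proj)
  qed (simp add: open_chart_image c)
qed

lemma smooth_function_cong:
  assumes "smooth_function \<A> f" "\<And>p. p \<in> points \<A> \<Longrightarrow> f p = g p"
  shows "smooth_function \<A> g"
  unfolding smooth_function_def
proof
  fix c assume c: "c \<in> \<A>"
  show "smooth_on (chart_image c) (g \<circ> chart_inv c)"
  proof (rule smooth_on_cong)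
    show "smooth_on (chart_image c) (f \<circ> chart_inv c)" using assms(1) c by (simp add: smooth_function_def)
    fix x assume "x \<in> chart_image c"
    then show "(f \<circ> chart_inv c) x = (g \<circ> chart_inv c) x"
      using assms(2)[of "nil_proj x"] nil_proj_in_chart[OF c, of x] c
      by (simp add: chart_inv_nil_proj pointI)
  qed (simp add: open_chart_image c)
qed

lemma sum_apply: "(\<Sum>i\<in>I. f i) x = (\<Sum>i\<in>I. f i x)" for f :: "'i \<Rightarrow> 'b \<Rightarrow> 'c::comm_monoid_add"
  by (induction I rule: infinite_finite_induct) simp_all

lemma frame_sum: "frame (\<Sum>i\<in>I. f i) = (\<Sum>i\<in>I. frame (f i))"
  by (induction I rule: infinite_finite_induct) (simp_all add: frame_zero frame_add)

text \<open>Since the frame and the smooth coefficients are global, a tensorial expression at a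
  point can be evaluated from the coefficients there.\<close>

lemma frame_expansion:
  assumes "X \<in> vector_fields \<A>"
  shows "X = (\<Sum>b\<in>Basis. fscale (\<lambda>p. frame_coeff p (X p) \<bullet> b) (frame b))"
proof
  fix p
  have "X p = frame (\<Sum>b\<in>Basis. (frame_coeff p (X p) \<bullet> b) *\<^sub>R b) p"
    by (simp add: euclidean_representation frame_frame_coeff vector_field_tangent assms)
  also have "\<dots> = (\<Sum>b\<in>Basis. tscale (frame_coeff p (X p) \<bullet> b) (frame b p))"
    by (simp add: frame_sum sum_apply frame_scale)
  finally show "X p = (\<Sum>b\<in>Basis. fscale (\<lambda>p. frame_coeff p (X p) \<bullet> b) (frame b)) p"
    by (simp add: sum_apply fscale_def)
qed

text \<open>The component of \<open>frame b\<close> is the affine map sending \<open>x\<close> to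
  \<open>b + [x,b]/2\<close>, with derivative \<open>[v,b]/2\<close>. Antisymmetry adds the two
  halves, and the corrections by \<open>left_trans\<close> are nested brackets.\<close>

lemma lie_bracket_frame: "lie_bracket \<A> (frame a) (frame b) = frame (nil_bracket a b)"
proof (intro ext)
  fix p c
  have der: "frechet_derivative (components (frame b) c) (at (snd c p)) =
      (\<lambda>v. (1/2) *\<^sub>R nil_bracket v b)" if c: "c \<in> \<A>" "p \<in> fst c" for b
  proof (rule frechet_derivative_at[symmetric])
    have "((\<lambda>x. left_trans x b) has_derivative (\<lambda>v. (1/2) *\<^sub>R nil_bracket v b)) (at (snd c p))"
      unfolding left_trans_def
      by (auto intro!: derivative_eq_intros bounded_linear.has_derivative[OF nil_bracket.bounded_linear_left])
    then show "(components (frame b) c has_derivative (\<lambda>v. (1/2) *\<^sub>R nil_bracket v b)) (at (snd c p))"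
      by (rule has_derivative_transform_within_open[where s = "chart_image c"])
        (use c in \<open>auto simp: open_chart_image snd_chart chart_inv_nil_proj components_def frame_apply
          nil_proj_in_chart chart_nil_proj\<close>)
  qed
  show "lie_bracket \<A> (frame a) (frame b) p c = frame (nil_bracket a b) p c"
    by (auto simp: lie_bracket_def frame_def der left_trans_def nil_bracket_linear nil_bracket_nested
        nil_bracket_swap[of b a] simp flip: scaleR_left_distrib)
qed

text \<open>The lift of \<open>frame a p\<close> to any representative \<open>n\<close> is
  \<open>left_trans n a\<close>, which the left-invariant metric translates back to
  \<open>a\<close>. The result is therefore independent of the chosen \<open>n\<close>.\<close>

lemma nilmanifold_metric_frame:
  assumes "p \<in> points \<A>"
  shows "nilmanifold_metric p (frame a p) (frame b p) = a \<bullet> b"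
proof -
  define n where "n = (SOME n. nil_proj n = p)"
  obtain c where c: "c \<in> \<A>" "p \<in> fst c" using assms by (rule pointE)
  then have "nil_proj (snd c p) = p" by (simp add: snd_chart)
  then have n: "nil_proj n = p" unfolding n_def by (rule someI)
  have diff: "differential \<A> nil_proj n v = frame (left_trans (- n) v) p" for v
  proof
    fix d
    show "differential \<A> nil_proj n v d = frame (left_trans (- n) v) p d"
    proof (cases "d \<in> \<A> \<and> p \<in> fst d")
      case True
      then have "(snd d \<circ> nil_proj has_derivative (\<lambda>a. left_trans (snd d p) (left_trans (- n) a))) (at n)"
        using chart_local_lift[of d n] by (simp add: n comp_def)
      from frechet_derivative_at[OF this, symmetric] True show ?thesis
        by (simp add: differential_def n frame_apply)
    qed (auto simp: differential_def n frame_def)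
  qed
  have "inj (differential \<A> nil_proj n)"
    by (rule injI) (metis assms diff frame_inject left_trans_minus(1))
  then have lift: "inv_into UNIV (differential \<A> nil_proj n) (frame a p) = left_trans n a" for a
    by (rule inv_f_eq) (simp add: diff)
  have "frechet_derivative (\<lambda>x. inv\<^bsub>nil_group\<^esub> n \<otimes>\<^bsub>nil_group\<^esub> x) (at n) = left_trans (- n)"
    using frechet_derivative_at[OF has_derivative_nil_mult[of "- n" n]] by simp
  then show ?thesis
    by (simp add: nilmanifold_metric_def Let_def lift nil_metric_def flip: n_def)
qed

section \<open>The Levi-Civita connection in the frame\<close>

text \<open>Writing V and W for the parts \<open>(L, R)\<close> and \<open>(L', R')\<close>, this is
  \<open>1/2 ([a,b]' - j' C' V - j' C W)\<close>, the solution of the Koszul formula for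
  left-invariant fields.\<close>

fun conn :: "nil_n \<Rightarrow> nil_n \<Rightarrow> nil_n" where
  "conn ((L, R), C) ((L', R'), C') =
    (1/2) *\<^sub>R ((- cross3 R C' - cross3 R' C, - cross3 L C' - cross3 L' C), cross3 L' R + cross3 R' L)"

definition curv :: "nil_n \<Rightarrow> nil_n \<Rightarrow> nil_n \<Rightarrow> nil_n" where
  "curv a b c = conn a (conn b c) - conn b (conn a c) - conn (nil_bracket a b) c"

text \<open>Inner products of left-invariant fields are constant, so only the three bracket terms of
  the Koszul formula remain.\<close>

lemma conn_koszul:
  "2 * (conn a b \<bullet> c) = nil_bracket a b \<bullet> c - nil_bracket b c \<bullet> a + nil_bracket c a \<bullet> b"
proof -
  obtain L R C L' R' C' L'' R'' C'' where "a = ((L, R), C)" "b = ((L', R'), C')" "c = ((L'', R''), C'')"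
    by (metis prod.collapse)
  note abc = this
  have "2 * (conn a b \<bullet> c) = (2 *\<^sub>R conn a b) \<bullet> c" by simp
  also have "2 *\<^sub>R conn a b =
      ((- cross3 R C' - cross3 R' C, - cross3 L C' - cross3 L' C), cross3 L' R + cross3 R' L)"
    by (simp add: abc)
  also have "\<dots> \<bullet> c = nil_bracket a b \<bullet> c - nil_bracket b c \<bullet> a + nil_bracket c a \<bullet> b"
    by (simp add: abc nil_bracket_eq inner_vec_def sum_3 cross3_simps)
  finally show ?thesis .
qed

lemma bilinear_conn: "bilinear conn"
proof -
  have "conn a (b + b') = conn a b + conn a b'" "conn (a + a') b = conn a b + conn a' b"
    "conn (r *\<^sub>R a) b = r *\<^sub>R conn a b" "conn a (r *\<^sub>R b) = r *\<^sub>R conn a b" for a a' b b' r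
  proof -
    obtain L R C L' R' C' L1 R1 C1 L1' R1' C1' where
      "a = ((L, R), C)" "b = ((L', R'), C')" "a' = ((L1, R1), C1)" "b' = ((L1', R1'), C1')"
      by (metis prod.collapse)
    then show "conn a (b + b') = conn a b + conn a b'" "conn (a + a') b = conn a b + conn a' b"
      "conn (r *\<^sub>R a) b = r *\<^sub>R conn a b" "conn a (r *\<^sub>R b) = r *\<^sub>R conn a b"
      by (simp_all add: cross_add_left cross_add_right cross_mult_left cross_mult_right algebra_simps)
  qed
  then show ?thesis by (simp add: bilinear_def linear_iff)
qed

lemma linear_curv: "linear (\<lambda>a. curv a b c)"
  by (rule linearI)
    (simp_all add: curv_def bilinear_ladd[OF bilinear_conn] bilinear_radd[OF bilinear_conn]
      bilinear_lmul[OF bilinear_conn] bilinear_rmul[OF bilinear_conn] nil_bracket_linear algebra_simps)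

lemma vderiv_const:
  assumes "p \<in> points \<A>" "\<And>q. q \<in> points \<A> \<Longrightarrow> f q = r"
  shows "vderiv \<A> X f p = 0"
proof -
  define c where "c = chart_at \<A> p"
  have "\<exists>c. c \<in> \<A> \<and> p \<in> fst c" by (rule pointE[OF assms(1)]) blast
  from someI_ex[OF this] have c: "c \<in> \<A>" "p \<in> fst c" unfolding c_def chart_at_def by blast+
  have "(f \<circ> chart_inv c has_derivative (\<lambda>v. 0)) (at (snd c p))"
    by (rule has_derivative_transform_within_open[OF has_derivative_const[of r] open_chart_image[OF c(1)]])
      (use c assms(2) in \<open>simp_all add: snd_chart chart_inv_nil_proj nil_proj_in_chart pointI\<close>)
  then show ?thesis
    by (simp add: vderiv_def Let_def frechet_derivative_at[symmetric] flip: c_def)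
qed

lemma fscale_distribs:
  "fscale f (X - Y) = fscale f X - fscale f Y"
  "fscale f (X + Y) = fscale f X + fscale f Y"
  "fscale f (fscale h X) = fscale h (fscale f X)"
  "fscale f (- X) = - fscale f X"
  by (auto simp: fscale_def tscale_def fun_eq_iff algebra_simps)

section \<open>Consequences of the axioms for an arbitrary Levi-Civita connection\<close>

locale nil_connection =
  fixes D :: "(nil_n set, nil_n) connection"
  assumes levi_civita: "levi_civita \<A> nilmanifold_metric D"
begin

abbreviation "VF \<equiv> vector_fields \<A>"

lemma D_field: "X \<in> VF \<Longrightarrow> Y \<in> VF \<Longrightarrow> D X Y \<in> VF"
  using levi_civita unfolding levi_civita_def by blast

lemma D_add_left: "X \<in> VF \<Longrightarrow> X' \<in> VF \<Longrightarrow> Y \<in> VF \<Longrightarrow> D (X + X') Y = D X Y + D X' Y"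
  using levi_civita unfolding levi_civita_def by blast

lemma D_add_right: "X \<in> VF \<Longrightarrow> Y \<in> VF \<Longrightarrow> Y' \<in> VF \<Longrightarrow> D X (Y + Y') = D X Y + D X Y'"
  using levi_civita unfolding levi_civita_def by blast

lemma D_fscale_left: "smooth_function \<A> f \<Longrightarrow> X \<in> VF \<Longrightarrow> Y \<in> VF \<Longrightarrow> D (fscale f X) Y = fscale f (D X Y)"
  using levi_civita unfolding levi_civita_def by blast

lemma D_leibniz:
  "smooth_function \<A> f \<Longrightarrow> X \<in> VF \<Longrightarrow> Y \<in> VF \<Longrightarrow>
    D X (fscale f Y) = fscale f (D X Y) + fscale (vderiv \<A> X f) Y"
  using levi_civita unfolding levi_civita_def by blast

text \<open>Vanishing torsion, oriented so as to eliminate brackets: closure of the fields under the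
  bracket and its Leibniz rule are then inherited from \<open>D\<close>.\<close>

lemma lie_bracket_eq: "X \<in> VF \<Longrightarrow> Y \<in> VF \<Longrightarrow> lie_bracket \<A> X Y = D X Y - D Y X"
  using levi_civita unfolding levi_civita_def by metis

lemma D_metric:
  "X \<in> VF \<Longrightarrow> Y \<in> VF \<Longrightarrow> Z \<in> VF \<Longrightarrow> p \<in> points \<A> \<Longrightarrow>
    vderiv \<A> X (metric_on_fields nilmanifold_metric Y Z) p =
      metric_on_fields nilmanifold_metric (D X Y) Z p + metric_on_fields nilmanifold_metric Y (D X Z) p"
  using levi_civita unfolding levi_civita_def by blast

lemma D_diff_left: "X \<in> VF \<Longrightarrow> X' \<in> VF \<Longrightarrow> Y \<in> VF \<Longrightarrow> D (X - X') Y = D X Y - D X' Y"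
  using D_add_left[of "X - X'" X' Y] by (simp add: vector_field_diff algebra_simps)

lemma lie_bracket_field: "X \<in> VF \<Longrightarrow> Y \<in> VF \<Longrightarrow> lie_bracket \<A> X Y \<in> VF"
  by (simp add: lie_bracket_eq vector_field_diff D_field)

text \<open>This is the uniqueness argument of the fundamental theorem of Riemannian geometry,
  carried out on frame coefficients at each point.\<close>

lemma D_frame: "D (frame a) (frame b) = frame (conn a b)"
proof
  fix p
  show "D (frame a) (frame b) p = frame (conn a b) p"
  proof (cases "p \<in> points \<A>")
    case True
    define w where "w a b = frame_coeff p (D (frame a) (frame b) p)" for a b
    have w: "D (frame a) (frame b) p = frame (w a b) p" for a b
      unfolding w_def by (simp add: frame_frame_coeff vector_field_tangent D_field frame_vector_field)
    have metric: "w a b \<bullet> c + w a c \<bullet> b = 0" for a b c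
    proof -
      have "vderiv \<A> (frame a) (metric_on_fields nilmanifold_metric (frame b) (frame c)) p = 0"
        using True by (rule vderiv_const) (simp add: metric_on_fields_def nilmanifold_metric_frame)
      then show ?thesis
        using D_metric[OF frame_vector_field frame_vector_field frame_vector_field True, of a b c]
        by (simp add: metric_on_fields_def w nilmanifold_metric_frame True inner_commute)
    qed
    have torsion: "w a b - w b a = nil_bracket a b" for a b
    proof -
      have "frame (w a b - w b a) p = frame (nil_bracket a b) p"
        using fun_cong[OF lie_bracket_eq[OF frame_vector_field frame_vector_field], of a b p]
        by (simp add: lie_bracket_frame frame_diff w)
      then show ?thesis by (simp add: frame_inject True)
    qed
    have "w a b \<bullet> c = conn a b \<bullet> c" for c
    proof -
      have "w a b \<bullet> c - w b a \<bullet> c = nil_bracket a b \<bullet> c" for a b c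
        by (simp add: torsion flip: inner_diff_left)
      \<comment> \<open>The torsion equations for the three cyclic permutations, taken with the
        signs of the Koszul formula, combine with the three metric equations to twice the wanted
        component.\<close>
      from conn_koszul[of a b c] this[of a b c] this[of b c a] this[of c a b]
        metric[of a b c] metric[of b c a] metric[of c a b]
      show ?thesis by linarith
    qed
    then show ?thesis unfolding w using vector_eq_rdot by metis
  next
    case False
    then show ?thesis
      by (metis D_field frame_vector_field tangent_not_point vector_field_tangent)
  qed
qed

section \<open>The curvature as a tensor in its first two arguments\<close>

abbreviation "Rm \<equiv> curvature \<A> D"

lemma curvature_frame: "Rm (frame a) (frame b) (frame c) = frame (curv a b c)"
  by (simp add: curvature_def D_frame lie_bracket_frame frame_diff curv_def)

lemma curvature_swap:
  assumes "X \<in> VF" "Y \<in> VF" "Z \<in> VF"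
  shows "Rm X Y Z = - Rm Y X Z"
proof -
  have "D (lie_bracket \<A> X Y) Z = - D (lie_bracket \<A> Y X) Z"
    using assms by (simp add: lie_bracket_eq D_diff_left D_field)
  then show ?thesis by (simp add: curvature_def)
qed

lemma curvature_add:
  assumes "X \<in> VF" "X' \<in> VF" "Y \<in> VF" "Z \<in> VF"
  shows "Rm (X + X') Y Z = Rm X Y Z + Rm X' Y Z"
  using assms
  by (simp add: curvature_def lie_bracket_eq D_add_left D_add_right D_diff_left D_field
      vector_field_add)

lemma curvature_sum:
  assumes "\<And>i. i \<in> I \<Longrightarrow> X i \<in> VF" "Y \<in> VF" "Z \<in> VF"
  shows "Rm (\<Sum>i\<in>I. X i) Y Z = (\<Sum>i\<in>I. Rm (X i) Y Z)"
proof -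
  have "0 \<in> VF" using frame_vector_field[of 0] by (simp add: frame_zero)
  then have "Rm 0 Y Z = 0" using curvature_add[of 0 0 Y Z] assms by simp
  with assms(1) show ?thesis
    by (induction I rule: infinite_finite_induct)
      (simp_all add: curvature_add vector_field_sum assms(2,3))
qed

text \<open>
  The Leibniz rule exhibits the product of \<open>Y f\<close> with a frame field as a vector field, whose
  coefficients are smooth.
\<close>
lemma smooth_function_vderiv:
  assumes "smooth_function \<A> f" "Y \<in> VF"
  shows "smooth_function \<A> (vderiv \<A> Y f)"
proof -
  obtain b :: nil_n where b: "b \<in> Basis" using nonempty_Basis by blast
  define V where "V = D Y (fscale f (frame b)) - fscale f (D Y (frame b))"
  have "V \<in> VF"
    unfolding V_def using assms
    by (simp add: vector_field_diff D_field vector_field_fscale frame_vector_field)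
  then have "smooth_function \<A> (\<lambda>p. frame_coeff p (V p) \<bullet> b)"
    by (rule smooth_function_frame_coeff)
  moreover have "V = fscale (vderiv \<A> Y f) (frame b)"
    unfolding V_def using assms by (simp add: D_leibniz frame_vector_field)
  then have "V p = frame (vderiv \<A> Y f p *\<^sub>R b) p" for p
    by (simp add: fscale_def frame_scale)
  ultimately show ?thesis
    by (elim smooth_function_cong) (simp add: b inner_Basis)
qed

text \<open>Differentiating the factor \<open>f\<close> in \<open>D Y (fscale f (D X Z))\<close>
  produces \<open>Y f\<close> times \<open>D X Z\<close>, and the correction term of the bracket of
  \<open>fscale f X\<close> and \<open>Y\<close> cancels it.\<close>

lemma curvature_fscale:
  assumes f: "smooth_function \<A> f" and "X \<in> VF" "Y \<in> VF" "Z \<in> VF"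
  shows "Rm (fscale f X) Y Z = fscale f (Rm X Y Z)"
proof -
  note fields = assms vector_field_diff D_field vector_field_fscale smooth_function_vderiv
  have "lie_bracket \<A> (fscale f X) Y = fscale f (lie_bracket \<A> X Y) - fscale (vderiv \<A> Y f) X"
    by (simp add: lie_bracket_eq D_fscale_left D_leibniz fields fscale_distribs algebra_simps)
  then show ?thesis
    by (simp add: curvature_def D_fscale_left D_leibniz D_diff_left fields lie_bracket_field fscale_distribs)
qed

text \<open>Meant for fields such as \<open>on_fields T V X\<close>, whose frame coefficients are
  not known to be constant: only the value at \<open>p\<close> enters.\<close>

lemma curvature_first:
  assumes "W \<in> VF" "W p = frame w p"  "p \<in> points \<A>"
  shows "Rm W (frame b) (frame c) p = frame (curv w b c) p"
proof -
  have w: "frame_coeff p (W p) = w" using assms by simp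
  have "Rm W (frame b) (frame c) =
      Rm (\<Sum>e\<in>Basis. fscale (\<lambda>p. frame_coeff p (W p) \<bullet> e) (frame e)) (frame b) (frame c)"
    using frame_expansion[OF assms(1)] by simp
  also have "\<dots> = (\<Sum>e\<in>Basis. fscale (\<lambda>p. frame_coeff p (W p) \<bullet> e) (frame (curv e b c)))"
    by (simp add: curvature_sum curvature_fscale curvature_frame vector_field_fscale
        smooth_function_frame_coeff assms(1) frame_vector_field)
  finally have "Rm W (frame b) (frame c) p = frame (\<Sum>e\<in>Basis. (w \<bullet> e) *\<^sub>R curv e b c) p"
    by (simp add: sum_apply fscale_def frame_sum frame_scale w)
  also have "(\<Sum>e\<in>Basis. (w \<bullet> e) *\<^sub>R curv e b c) = curv (\<Sum>e\<in>Basis. (w \<bullet> e) *\<^sub>R e) b c"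
    by (simp add: linear_sum[OF linear_curv] linear_scale[OF linear_curv])
  finally show ?thesis by (simp add: euclidean_representation)
qed

lemma curvature_second:
  assumes "W \<in> VF" "W p = frame w p"  "p \<in> points \<A>"
  shows "Rm (frame a) W (frame c) p = frame (curv a w c) p"
proof -
  have "curv a w c = - curv w a c"
    using bilinear_conn by (simp add: curv_def nil_bracket_swap[of w a] bilinear_lneg)
  then show ?thesis
    using curvature_first[OF assms, of a c] curvature_swap[of "frame a" W "frame c"] assms(1)
    by (simp add: frame_vector_field frame_minus)
qed

end

section \<open>Two components of the equation for the derivative of the curvature\<close>

lemma homogeneous_structure_algebra:
  fixes t :: "nil_n \<Rightarrow> nil_n \<Rightarrow> nil_n"
  assumes bil: "bilinear t" and skew: "\<And>a b c. t a b \<bullet> c + b \<bullet> t a c = 0" and null: "\<And>a. t a a = 0"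
    and eq: "\<And>v x y. conn v (curv x y v) - curv (conn v x) y v - curv x (conn v y) v - curv x y (conn v v)
       = t v (curv x y v) - curv (t v x) y v - curv x (t v y) v"
  shows False
proof -
  \<comment> \<open>In the notation of quaternions these are \<open>X_i\<close>, \<open>X_k\<close>,
    \<open>Y_j\<close>, \<open>Z_i\<close> and \<open>Z_k\<close>.\<close>
  define L1 L3 R2 C1 C3 :: nil_n where
    "L1 = ((axis 1 1, 0), 0)" and "L3 = ((axis 3 1, 0), 0)" and "R2 = ((0, axis 2 1), 0)" and
    "C1 = (0, axis 1 1)" and "C3 = (0, axis 3 1)"
  note defs = L1_def L3_def R2_def C1_def C3_def zero_prod_def
  note calc = curv_def nil_bracket_eq defs cross3_def axis_def inner_vec_def sum_3 vec_eq_iff forall_3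
  have alt: "t a b = - t b a" for a b
  proof -
    have "t (a + b) (a + b) = t a b + t b a"
      unfolding bilinear_ladd[OF bil] bilinear_radd[OF bil] by (simp add: null)
    then show ?thesis by (simp add: null eq_neg_iff_add_eq_0)
  qed
  \<comment> \<open>The vector \<open>u\<close> stands for an unknown value of \<open>t\<close>;
    each needed curvature component sees at most one coordinate of it.\<close>
  have curv_values: "curv L1 R2 L1 = (3/4) *\<^sub>R R2" "curv L1 u L1 \<bullet> C3 = - (1/4) * (u \<bullet> C3)"
    "curv L3 R2 C3 = 0" "curv u R2 C3 \<bullet> C1 = 0" "curv L3 u C3 \<bullet> C1 = (1/4) * (u \<bullet> L1)" for u
    by (cases u rule: prod.exhaust; cases "fst u"; simp add: calc)+
  \<comment> \<open>Here \<open>t L1 L1\<close> vanishes, and the other two terms contain the same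
    unknown with coefficients 3/4 and 1/4, which add up to 1.\<close>
  have "(t L1 (curv L1 R2 L1) - curv (t L1 L1) R2 L1 - curv L1 (t L1 R2) L1) \<bullet> C3 = - 1/2"
    unfolding eq[symmetric] by (simp add: calc)
  then have "t L1 R2 \<bullet> C3 = - 1/2"
    by (simp add: curv_values inner_diff_left bilinear_rmul[OF bil] null linear_0[OF linear_curv])
  moreover
  \<comment> \<open>The first two terms contribute nothing, and the third is -1/4 times the
    unknown.\<close>
  have "(t C3 (curv L3 R2 C3) - curv (t C3 L3) R2 C3 - curv L3 (t C3 R2) C3) \<bullet> C1 = 1/8"
    unfolding eq[symmetric] by (simp add: calc)
  then have "t C3 R2 \<bullet> L1 = - 1/2"
    by (simp add: curv_values inner_diff_left bilinear_rzero[OF bil])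
  \<comment> \<open>Antisymmetry in the first two and in the last two slots gives the sign of every
    permutation; exchanging \<open>C3\<close> and \<open>L1\<close> is odd.\<close>
  moreover have "t C3 R2 \<bullet> L1 = - (t L1 R2 \<bullet> C3)"
  proof -
    have "t C3 R2 \<bullet> L1 = - (t C3 L1 \<bullet> R2)" using skew[of C3 R2 L1] by (simp add: inner_commute)
    also have "\<dots> = t L1 C3 \<bullet> R2" using alt[of C3 L1] by simp
    also have "\<dots> = - (t L1 R2 \<bullet> C3)" using skew[of L1 C3 R2] by (simp add: inner_commute)
    finally show ?thesis .
  qed
  ultimately show False by simp
qed

section \<open>From a homogeneous structure on the manifold to the algebra at one point\<close>

context nil_connection
begin

lemma not_naturally_reductive_structure:
  assumes hom: "homogeneous_structure \<A> nilmanifold_metric D T"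
    and null: "\<And>X. X \<in> VF \<Longrightarrow> on_fields T X X = 0"
  shows False
proof -
  define p where "p = nil_proj 0"
  have p: "p \<in> points \<A>" unfolding p_def by (rule origin_in_points)
  \<comment> \<open>The coefficients of \<open>T\<close> may vary over the manifold;
    \<open>t\<close> records them at \<open>p\<close> alone, and the argument takes place at this
    point.\<close>
  define t where "t a b = frame_coeff p (T p (frame a p) (frame b p))" for a b
  note fv = frame_vector_field frame_tangent
  have tensor: "tensor_field21 \<A> T" using hom by (simp add: homogeneous_structure_def)
  have T_field: "X \<in> VF \<Longrightarrow> Y \<in> VF \<Longrightarrow> on_fields T X Y \<in> VF" for X Y
    using tensor unfolding tensor_field21_def by blast
  have T_frame: "T p (frame a p) (frame b p) = frame (t a b) p" for a b
    unfolding t_def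
    using vector_field_tangent[OF T_field[OF fv(1) fv(1)], of a b p]
    by (simp add: on_fields_def frame_frame_coeff)
  have on_frame: "on_fields T (frame a) (frame b) p = frame (t a b) p" for a b
    by (simp add: on_fields_def T_frame)
  have lin: "T p (u + w) v = T p u v + T p w v" "T p (tscale r u) v = tscale r (T p u v)"
      "T p u (v + w) = T p u v + T p u w" "T p u (tscale r v) = tscale r (T p u v)"
    if "u \<in> tangent_space \<A> p" "v \<in> tangent_space \<A> p" "w \<in> tangent_space \<A> p" for u v w r
    using tensor p that unfolding tensor_field21_def by blast+
  have "t (a + a') b = t a b + t a' b" "t (r *\<^sub>R a) b = r *\<^sub>R t a b"
    "t a (b + b') = t a b + t a b'" "t a (r *\<^sub>R b) = r *\<^sub>R t a b" for a a' b b' r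
  proof -
    have "frame (t (a + a') b) p = frame (t a b + t a' b) p" "frame (t (r *\<^sub>R a) b) p = frame (r *\<^sub>R t a b) p"
      "frame (t a (b + b')) p = frame (t a b + t a b') p" "frame (t a (r *\<^sub>R b)) p = frame (r *\<^sub>R t a b) p"
      by (simp_all add: frame_add frame_scale lin[OF fv(2) fv(2) fv(2)] flip: T_frame)
    then show "t (a + a') b = t a b + t a' b" "t (r *\<^sub>R a) b = r *\<^sub>R t a b"
      "t a (b + b') = t a b + t a b'" "t a (r *\<^sub>R b) = r *\<^sub>R t a b"
      by (simp_all only: frame_inject[OF p])
  qed
  then have bil: "bilinear t" by (simp add: bilinear_def linear_iff)
  have skew: "t a b \<bullet> c + b \<bullet> t a c = 0" for a b c
  proof -
    have "metric_on_fields nilmanifold_metric (on_fields T (frame a) (frame b)) (frame c) p +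
        metric_on_fields nilmanifold_metric (frame b) (on_fields T (frame a) (frame c)) p = 0"
      using hom p fv(1) unfolding homogeneous_structure_def by blast
    then show ?thesis by (simp add: metric_on_fields_def on_frame nilmanifold_metric_frame p)
  qed
  have null': "t a a = 0" for a
  proof -
    have "frame (t a a) p = frame 0 p"
      using null[OF fv(1), of a] by (simp add: frame_zero flip: on_frame)
    then show ?thesis by (simp only: frame_inject[OF p])
  qed
  have "conn v (curv x y v) - curv (conn v x) y v - curv x (conn v y) v - curv x y (conn v v)
       = t v (curv x y v) - curv (t v x) y v - curv x (t v y) v" for v x y
  proof -
    let ?v = "frame v" and ?x = "frame x" and ?y = "frame y"
    have "deriv_curvature \<A> D ?v ?x ?y ?v =
        on_fields T ?v (Rm ?x ?y ?v) - Rm (on_fields T ?v ?x) ?y ?v - Rm ?x (on_fields T ?v ?y) ?v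
          - Rm ?x ?y (on_fields T ?v ?v)"
      using hom fv(1) unfolding homogeneous_structure_def by blast
    \<comment> \<open>Writing the zero field as \<open>frame 0\<close> brings the last curvature
      term within reach of \<open>curvature_frame\<close>.\<close>
    moreover have "on_fields T ?v ?v = frame 0" using null[OF fv(1)] by (simp add: frame_zero)
    moreover have "deriv_curvature \<A> D ?v ?x ?y ?v =
        frame (conn v (curv x y v) - curv (conn v x) y v - curv x (conn v y) v - curv x y (conn v v))"
      by (simp add: deriv_curvature_def curvature_frame D_frame frame_diff)
    moreover have "Rm ?x ?y (frame 0) = frame 0"
      by (simp add: curvature_frame curv_def bilinear_rzero[OF bilinear_conn])
    \<comment> \<open>At \<open>p\<close> the fields obtained from \<open>T\<close> enter the first
      two slots of the curvature only through their values, so \<open>t\<close> can replace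
      them.\<close>
    ultimately have "frame (conn v (curv x y v) - curv (conn v x) y v - curv x (conn v y) v - curv x y (conn v v)) p
        = frame (t v (curv x y v) - curv (t v x) y v - curv x (t v y) v) p"
      by (simp add: curvature_frame curvature_first[OF T_field[OF fv(1) fv(1)] on_frame p]
          curvature_second[OF T_field[OF fv(1) fv(1)] on_frame p] on_frame frame_diff frame_zero)
    then show ?thesis by (simp only: frame_inject[OF p])
  qed
  with bil skew null' show False by (rule homogeneous_structure_algebra)
qed

end

theorem proposition3p3:
  shows "\<not> naturally_reductive nilmanifold_atlas nilmanifold_metric"
  unfolding naturally_reductive_def
  using nil_connection.not_naturally_reductive_structure[OF nil_connection.intro] by blast

end
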